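(* Let $d, e, f \in \mathbb{C}$ and let $$M = \begin{pmatrix} d & 0 & 0 \\ 0 & e & 0 \\ 0 & 0 & f \end{pmatrix} \in \mathbb{C}^{3\times 3}.$$ Then $\mathrm{Toep}(M) = 3$ if and only if $d \neq e \neq f \neq d$ (that is, $d, e, f$ are pairwise distinct) and $e \neq 0$.
   Context: A matrix $T \in \mathbb{C}^{n\times n}$ is called Toeplitz if $T_{i,j} = T_{i+1,j+1}$ for all $i,j \in \{1,\dots,n-1\}$. For $M \in \mathbb{C}^{n\times n}$, the Toeplitz number $\mathrm{Toep}(M)$ is the minimal integer $s \geq 1$ such that $M = T_1 T_2 \cdots T_s$ for some Toeplitz matrices $T_1, \dots, T_s \in \mathbb{C}^{n\times n}$. *)

theory Defs
  imports "Jordan_Normal_Form.Matrix"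
begin

definition toeplitz :: "nat \<Rightarrow> complex mat \<Rightarrow> bool" where
  "toeplitz n T \<longleftrightarrow> T \<in> carrier_mat n n \<and>
     (\<forall>i j. Suc i < n \<longrightarrow> Suc j < n \<longrightarrow> T $$ (i, j) = T $$ (Suc i, Suc j))"

definition toeplitz_product :: "nat \<Rightarrow> nat \<Rightarrow> complex mat \<Rightarrow> bool" where
  "toeplitz_product n s M \<longleftrightarrow>
     (\<exists>Ts. length Ts = s \<and> (\<forall>T\<in>set Ts. toeplitz n T) \<and> M = foldr (*) Ts (1\<^sub>m n))"

(* Every square complex matrix is a finite product of Toeplitz matrices (Ye and Lim),
   so for square M the minimum is attained. *)
definition toep :: "complex mat \<Rightarrow> nat" where
  "toep M = (LEAST s. s \<ge> 1 \<and> toeplitz_product (dim_row M) s M)"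

end

theory Submission
  imports Defs
begin

text \<open>
  Write \<open>D = diag(d, e, f)\<close>. Appending identity factors shows that products of \<open>s\<close> Toeplitz
  matrices are also products of \<open>t \<ge> s\<close> of them, so \<open>Toep(D) = 3\<close> says that \<open>D\<close> is a product
  of three Toeplitz matrices but not of two (lemma \<open>toep_eq_Suc_iff\<close>).

  Two factors suffice in each excluded case. If \<open>d = e\<close> or \<open>e = f\<close>, multiply a weighted cyclic
  shift by the transpose of another one. If \<open>d = f\<close> or \<open>e = 0\<close>, use matrices supported on the main
  diagonal and the two corners: they act as a \<open>2 \<times> 2\<close> Toeplitz block on the outer coordinates and
  as a scalar on the middle one. Three matrices of the latter kind produce every \<open>D\<close> with
  \<open>e \<noteq> 0\<close> and \<open>d \<noteq> f\<close>.

  It remains to see that two factors \<open>A\<close>, \<open>B\<close> cannot produce \<open>D\<close> when \<open>d, e, f\<close> are distinct and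
  \<open>e \<noteq> 0\<close>. Eliminating between the off-diagonal equations of \<open>A * B = D\<close> gives
  \<open>\<alpha> * (f - d) = 0\<close> and \<open>\<beta> * (f - d) = 0\<close> for the main-diagonal values \<open>\<alpha>, \<beta>\<close> of \<open>A, B\<close>, so
  \<open>\<alpha> = \<beta> = 0\<close>. Then \<open>e\<close> is the sum of two products of first off-diagonal values; if one of these
  products is nonzero, the remaining equations force \<open>e = f\<close> or \<open>d = e\<close>.
\<close>

section \<open>Products with a varying number of Toeplitz factors\<close>

lemma toeplitz_one: "toeplitz n (1\<^sub>m n)"
  by (auto simp: toeplitz_def)

lemma toeplitz_product_Suc:
  assumes "toeplitz_product n s M"
  shows "toeplitz_product n (Suc s) M"
proof -
  from assms obtain Ts where "length Ts = s" "\<forall>T\<in>set Ts. toeplitz n T" "M = foldr (*) Ts (1\<^sub>m n)"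
    unfolding toeplitz_product_def by blast
  then show ?thesis
    unfolding toeplitz_product_def
    by (intro exI[of _ "Ts @ [1\<^sub>m n]"]) (auto simp: toeplitz_one)
qed

lemma toeplitz_product_mono:
  assumes "toeplitz_product n s M" and "s \<le> t"
  shows "toeplitz_product n t M"
  using assms(2,1) by (induction rule: dec_induct) (auto intro: toeplitz_product_Suc)

lemma toep_eq_Suc_iff:
  assumes "s \<ge> 1" and "toeplitz_product (dim_row M) (Suc s) M"
  shows "toep M = Suc s \<longleftrightarrow> \<not> toeplitz_product (dim_row M) s M"
proof
  assume "toep M = Suc s"
  then show "\<not> toeplitz_product (dim_row M) s M"
    using assms(1) not_less_Least[of s "\<lambda>s. s \<ge> 1 \<and> toeplitz_product (dim_row M) s M"]
    by (simp add: toep_def)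
next
  assume n: "\<not> toeplitz_product (dim_row M) s M"
  show "toep M = Suc s"
    unfolding toep_def
  proof (rule Least_equality)
    show "Suc s \<ge> 1 \<and> toeplitz_product (dim_row M) (Suc s) M"
      using assms(2) by simp
    show "Suc s \<le> t" if "t \<ge> 1 \<and> toeplitz_product (dim_row M) t M" for t
      using that n toeplitz_product_mono[of "dim_row M" t M s] by (meson not_less_eq_eq)
  qed
qed

lemma toeplitz_product_2_iff:
  "toeplitz_product n 2 M \<longleftrightarrow> (\<exists>A B. toeplitz n A \<and> toeplitz n B \<and> M = A * B)"
proof
  assume "toeplitz_product n 2 M"
  then obtain A B where "toeplitz n A" "toeplitz n B" "M = A * (B * 1\<^sub>m n)"
    unfolding toeplitz_product_def by (auto simp: numeral_2_eq_2 length_Suc_conv)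
  moreover from this have "B * 1\<^sub>m n = B"
    using right_mult_one_mat[of B n n] by (simp add: toeplitz_def)
  ultimately show "\<exists>A B. toeplitz n A \<and> toeplitz n B \<and> M = A * B"
    by auto
next
  assume "\<exists>A B. toeplitz n A \<and> toeplitz n B \<and> M = A * B"
  then obtain A B where "toeplitz n A" "toeplitz n B" "M = A * B"
    by blast
  then show "toeplitz_product n 2 M"
    unfolding toeplitz_product_def by (intro exI[of _ "[A, B]"]) (auto simp: toeplitz_def)
qed

lemma toeplitz_product_3I:
  assumes "toeplitz n A" "toeplitz n B" "toeplitz n C"
  shows "toeplitz_product n 3 (A * (B * C))"
  using assms unfolding toeplitz_product_def
  by (intro exI[of _ "[A, B, C]"]) (auto simp: toeplitz_def)

section \<open>Explicit 3 by 3 Toeplitz matrices\<close>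

lemma less_3_cases: "i < 3 \<longleftrightarrow> i = 0 \<or> i = 1 \<or> i = (2::nat)"
  by auto

lemma mult_mat_of_rows_list_3:
  fixes a b c d e f g h i :: "'a :: semiring_0"
  shows "mat_of_rows_list 3 [[a, b, c], [d, e, f], [g, h, i]] *
         mat_of_rows_list 3 [[a', b', c'], [d', e', f'], [g', h', i']] =
         mat_of_rows_list 3
           [[a * a' + b * d' + c * g', a * b' + b * e' + c * h', a * c' + b * f' + c * i'],
            [d * a' + e * d' + f * g', d * b' + e * e' + f * h', d * c' + e * f' + f * i'],
            [g * a' + h * d' + i * g', g * b' + h * e' + i * h', g * c' + h * f' + i * i']]"
  by (rule eq_matI)
    (auto simp: mat_of_rows_list_def scalar_prod_def less_3_cases numeral_3_eq_3 numeral_2_eq_2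
      less_Suc_eq)

lemma mat_of_rows_list_3_eq_iff:
  "mat_of_rows_list 3 [[a, b, c], [d, e, f], [g, h, i]] =
   mat_of_rows_list 3 [[a', b', c'], [d', e', f'], [g', h', i']] \<longleftrightarrow>
   [a, b, c, d, e, f, g, h, i] = [a', b', c', d', e', f', g', h', i']"
  (is "?A = ?B \<longleftrightarrow> _")
proof
  assume "?A = ?B"
  then have eq: "?A $$ (i, j) = ?B $$ (i, j)" for i j
    by simp
  show "[a, b, c, d, e, f, g, h, i] = [a', b', c', d', e', f', g', h', i']"
    using eq[of 0 0] eq[of 0 1] eq[of 0 2] eq[of 1 0] eq[of 1 1] eq[of 1 2] eq[of 2 0]
      eq[of 2 1] eq[of 2 2]
    by (simp add: mat_of_rows_list_def)
qed simp

definition toeplitz3 :: "complex \<Rightarrow> complex \<Rightarrow> complex \<Rightarrow> complex \<Rightarrow> complex \<Rightarrow> complex mat" where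
  "toeplitz3 c r\<^sub>1 r\<^sub>2 l\<^sub>1 l\<^sub>2 = mat_of_rows_list 3 [[c, r\<^sub>1, r\<^sub>2], [l\<^sub>1, c, r\<^sub>1], [l\<^sub>2, l\<^sub>1, c]]"

lemma toeplitz_toeplitz3: "toeplitz 3 (toeplitz3 c r\<^sub>1 r\<^sub>2 l\<^sub>1 l\<^sub>2)"
  by (auto simp: toeplitz_def toeplitz3_def mat_of_rows_list_def less_Suc_eq numeral_3_eq_3)

lemma toeplitz_3E:
  assumes "toeplitz 3 T"
  obtains c r\<^sub>1 r\<^sub>2 l\<^sub>1 l\<^sub>2 where "T = toeplitz3 c r\<^sub>1 r\<^sub>2 l\<^sub>1 l\<^sub>2"
proof -
  have T: "T \<in> carrier_mat 3 3"
    and eq: "\<And>i j. Suc i < 3 \<Longrightarrow> Suc j < 3 \<Longrightarrow> T $$ (i, j) = T $$ (Suc i, Suc j)"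
    using assms by (auto simp: toeplitz_def)
  have "T = toeplitz3 (T $$ (0, 0)) (T $$ (0, 1)) (T $$ (0, 2)) (T $$ (1, 0)) (T $$ (2, 0))"
    using T eq[of 0 0] eq[of 0 1] eq[of 1 0] eq[of 1 1]
    by (intro eq_matI) (auto simp: toeplitz3_def mat_of_rows_list_def less_3_cases
        numeral_2_eq_2 numeral_3_eq_3 less_Suc_eq)
  then show thesis
    by (rule that)
qed

section \<open>Diagonal matrices as products of two or three Toeplitz matrices\<close>

abbreviation diag3 :: "complex \<Rightarrow> complex \<Rightarrow> complex \<Rightarrow> complex mat" where
  "diag3 d e f \<equiv> mat_of_rows_list 3 [[d, 0, 0], [0, e, 0], [0, 0, f]]"

lemma diag3_toeplitz_product_2:
  assumes "d = e \<or> e = f \<or> f = d \<or> e = 0"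
  shows "toeplitz_product 3 2 (diag3 d e f)"
proof -
  consider "e = 0" | "e \<noteq> 0" "d = e" | "e \<noteq> 0" "f = e" | "e \<noteq> 0" "f = d"
    using assms by auto
  then have "\<exists>c r\<^sub>1 r\<^sub>2 l\<^sub>1 l\<^sub>2 c' r\<^sub>1' r\<^sub>2' l\<^sub>1' l\<^sub>2'.
    diag3 d e f = toeplitz3 c r\<^sub>1 r\<^sub>2 l\<^sub>1 l\<^sub>2 * toeplitz3 c' r\<^sub>1' r\<^sub>2' l\<^sub>1' l\<^sub>2'"
  proof cases
    case 1
    then have "diag3 d e f = toeplitz3 0 0 d 0 f * toeplitz3 0 0 1 0 1"
      by (simp add: toeplitz3_def mult_mat_of_rows_list_3)
    then show ?thesis by blast
  next
    case 2
    then have "diag3 d e f = toeplitz3 0 e 0 0 f * toeplitz3 0 0 1 1 0"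
      by (simp add: toeplitz3_def mult_mat_of_rows_list_3)
    then show ?thesis by blast
  next
    case 3
    then have "diag3 d e f = toeplitz3 0 0 d e 0 * toeplitz3 0 1 0 0 1"
      by (simp add: toeplitz3_def mult_mat_of_rows_list_3)
    then show ?thesis by blast
  next
    case 4
    then have "diag3 d e f = toeplitz3 e 0 e 0 (e - d) * toeplitz3 1 0 (-1) 0 (d / e - 1)"
      by (simp add: toeplitz3_def mult_mat_of_rows_list_3 mat_of_rows_list_3_eq_iff field_simps)
    then show ?thesis by blast
  qed
  then show ?thesis
    unfolding toeplitz_product_2_iff using toeplitz_toeplitz3 by blast
qed

text \<open>
  For \<open>e = 1\<close> and \<open>d \<noteq> 0\<close>, the choice \<open>l\<close>, \<open>-l\<close> for the lower corners of the first two factors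
  makes the product of their outer blocks upper triangular with diagonal \<open>1 - l * x\<close>,
  \<open>1 + l * y\<close>, where \<open>x, y\<close> are the upper corners. Solving for the diagonal \<open>d, f\<close>
  leaves an upper corner \<open>x + y\<close>, which a unipotent third factor removes. The general \<open>e\<close> scales
  the first factor. If \<open>d = 0\<close>, then \<open>f \<noteq> 0\<close> and the same recipe applies after reversing the order of
  the coordinates, which swaps \<open>d, f\<close> and transposes Toeplitz matrices.
\<close>

lemma diag3_toeplitz_product_3:
  assumes "e \<noteq> 0" and "d \<noteq> f"
  shows "toeplitz_product 3 3 (diag3 d e f)"
proof (cases "d = 0")
  case False
  have ne: "d - f \<noteq> 0"
    using assms by simp
  have "diag3 d e f = toeplitz3 e 0 ((e - d) * e / (d - f)) 0 (d - f) *
    (toeplitz3 1 0 ((f - e) / (d - f)) 0 ((f - d) / e) * toeplitz3 1 0 (e / d) 0 0)"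
    using assms False ne
    by (simp add: toeplitz3_def mult_mat_of_rows_list_3 mat_of_rows_list_3_eq_iff divide_simps)
      (auto simp: algebra_simps)
  then show ?thesis
    using toeplitz_product_3I toeplitz_toeplitz3 by metis
next
  case True
  have ne: "f - d \<noteq> 0" "f \<noteq> 0"
    using assms True by auto
  have "diag3 d e f = toeplitz3 e 0 (f - d) 0 ((e - f) * e / (f - d)) *
    (toeplitz3 1 0 ((d - f) / e) 0 ((d - e) / (f - d)) * toeplitz3 1 0 0 0 (e / f))"
    using assms True ne
    by (simp add: toeplitz3_def mult_mat_of_rows_list_3 mat_of_rows_list_3_eq_iff divide_simps)
  then show ?thesis
    using toeplitz_product_3I toeplitz_toeplitz3 by metis
qed

section \<open>Obstruction to two factors\<close>

lemma diag3_not_toeplitz_product_2: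
  assumes "d \<noteq> e" "e \<noteq> f" "f \<noteq> d" "e \<noteq> 0"
  shows "\<not> toeplitz_product 3 2 (diag3 d e f)"
proof
  assume "toeplitz_product 3 2 (diag3 d e f)"
  then obtain A B where "toeplitz 3 A" "toeplitz 3 B" and AB: "diag3 d e f = A * B"
    unfolding toeplitz_product_2_iff by blast
  obtain \<alpha> r\<^sub>1 r\<^sub>2 l\<^sub>1 l\<^sub>2 where A: "A = toeplitz3 \<alpha> r\<^sub>1 r\<^sub>2 l\<^sub>1 l\<^sub>2"
    using \<open>toeplitz 3 A\<close> by (rule toeplitz_3E)
  obtain \<beta> s\<^sub>1 s\<^sub>2 m\<^sub>1 m\<^sub>2 where B: "B = toeplitz3 \<beta> s\<^sub>1 s\<^sub>2 m\<^sub>1 m\<^sub>2"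
    using \<open>toeplitz 3 B\<close> by (rule toeplitz_3E)
  have diag: "d = \<alpha> * \<beta> + r\<^sub>1 * m\<^sub>1 + r\<^sub>2 * m\<^sub>2" "e = l\<^sub>1 * s\<^sub>1 + \<alpha> * \<beta> + r\<^sub>1 * m\<^sub>1"
      "f = l\<^sub>2 * s\<^sub>2 + l\<^sub>1 * s\<^sub>1 + \<alpha> * \<beta>"
    and off: "\<alpha> * s\<^sub>1 + r\<^sub>1 * \<beta> + r\<^sub>2 * m\<^sub>1 = 0" "\<alpha> * s\<^sub>2 + r\<^sub>1 * s\<^sub>1 + r\<^sub>2 * \<beta> = 0"
      "l\<^sub>1 * \<beta> + \<alpha> * m\<^sub>1 + r\<^sub>1 * m\<^sub>2 = 0" "l\<^sub>1 * s\<^sub>2 + \<alpha> * s\<^sub>1 + r\<^sub>1 * \<beta> = 0"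
      "l\<^sub>2 * \<beta> + l\<^sub>1 * m\<^sub>1 + \<alpha> * m\<^sub>2 = 0" "l\<^sub>2 * s\<^sub>1 + l\<^sub>1 * \<beta> + \<alpha> * m\<^sub>1 = 0"
    using AB by (simp_all add: A B toeplitz3_def mult_mat_of_rows_list_3 mat_of_rows_list_3_eq_iff)
  \<comment> \<open>The two entries of the product on the first superdiagonal differ only in these terms.\<close>
  have shift: "l\<^sub>1 * s\<^sub>2 - r\<^sub>2 * m\<^sub>1 = 0"
    using trans[OF off(4) off(1)[symmetric]] by simp
  have fd: "f - d = (l\<^sub>1 * s\<^sub>1 - r\<^sub>1 * m\<^sub>1) + (l\<^sub>2 * s\<^sub>2 - r\<^sub>2 * m\<^sub>2)"
    using diag by simp
  \<comment> \<open>In each combination below, all terms but the multiples of \<open>\<alpha>\<close> (respectively \<open>\<beta>\<close>) cancel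
    identically, and every summand vanishes by \<open>off\<close> or \<open>shift\<close>.\<close>
  have "\<alpha> * (f - d) =
      l\<^sub>1 * (l\<^sub>1 * s\<^sub>2 + \<alpha> * s\<^sub>1 + r\<^sub>1 * \<beta>) - r\<^sub>1 * (l\<^sub>2 * s\<^sub>1 + l\<^sub>1 * \<beta> + \<alpha> * m\<^sub>1)
      + l\<^sub>2 * (\<alpha> * s\<^sub>2 + r\<^sub>1 * s\<^sub>1 + r\<^sub>2 * \<beta>) - r\<^sub>2 * (l\<^sub>2 * \<beta> + l\<^sub>1 * m\<^sub>1 + \<alpha> * m\<^sub>2)
      - l\<^sub>1 * (l\<^sub>1 * s\<^sub>2 - r\<^sub>2 * m\<^sub>1)"
    unfolding fd by (simp add: algebra_simps)
  then have "\<alpha> * (f - d) = 0"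
    unfolding off shift by simp
  moreover have "\<beta> * (f - d) =
      s\<^sub>1 * (l\<^sub>1 * \<beta> + \<alpha> * m\<^sub>1 + r\<^sub>1 * m\<^sub>2) - m\<^sub>1 * (\<alpha> * s\<^sub>1 + r\<^sub>1 * \<beta> + r\<^sub>2 * m\<^sub>1)
      + s\<^sub>2 * (l\<^sub>2 * \<beta> + l\<^sub>1 * m\<^sub>1 + \<alpha> * m\<^sub>2) - m\<^sub>2 * (\<alpha> * s\<^sub>2 + r\<^sub>1 * s\<^sub>1 + r\<^sub>2 * \<beta>)
      - m\<^sub>1 * (l\<^sub>1 * s\<^sub>2 - r\<^sub>2 * m\<^sub>1)"
    unfolding fd by (simp add: algebra_simps)
  then have "\<beta> * (f - d) = 0"
    unfolding off shift by simp
  ultimately have zero: "\<alpha> = 0" "\<beta> = 0"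
    using assms by auto
  then have off0: "r\<^sub>2 * m\<^sub>1 = 0" "r\<^sub>1 * s\<^sub>1 = 0" "r\<^sub>1 * m\<^sub>2 = 0" "l\<^sub>1 * s\<^sub>2 = 0" "l\<^sub>1 * m\<^sub>1 = 0"
      "l\<^sub>2 * s\<^sub>1 = 0"
    using off by auto
  have "l\<^sub>1 * s\<^sub>1 \<noteq> 0 \<or> r\<^sub>1 * m\<^sub>1 \<noteq> 0"
    using diag(2) zero assms(4) by auto
  then show False
  proof
    assume "l\<^sub>1 * s\<^sub>1 \<noteq> 0"
    then have "r\<^sub>1 = 0" "l\<^sub>2 = 0"
      using off0 by auto
    then show False
      using diag zero assms(2) by simp
  next
    assume "r\<^sub>1 * m\<^sub>1 \<noteq> 0"
    then have "r\<^sub>2 = 0" "s\<^sub>1 = 0"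
      using off0 by auto
    then show False
      using diag zero assms(1) by simp
  qed
qed

theorem theorem3p2:
  fixes d e f :: complex
  defines "M \<equiv> mat_of_rows_list 3 [[d, 0, 0], [0, e, 0], [0, 0, f]]"
  shows "toep M = 3 \<longleftrightarrow> (d \<noteq> e \<and> e \<noteq> f \<and> f \<noteq> d) \<and> e \<noteq> 0"
proof -
  have dim: "dim_row M = 3"
    by (simp add: M_def mat_of_rows_list_def)
  have two: "toeplitz_product 3 2 M \<longleftrightarrow> \<not> ((d \<noteq> e \<and> e \<noteq> f \<and> f \<noteq> d) \<and> e \<noteq> 0)"
    unfolding M_def using diag3_toeplitz_product_2 diag3_not_toeplitz_product_2 by metis
  have three: "toeplitz_product 3 3 M"
  proof (cases "toeplitz_product 3 2 M")
    case True
    then show ?thesis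
      by (rule toeplitz_product_mono) simp
  next
    case False
    with two show ?thesis
      unfolding M_def using diag3_toeplitz_product_3 by metis
  qed
  have "toep M = 3 \<longleftrightarrow> \<not> toeplitz_product 3 2 M"
    using toep_eq_Suc_iff[of 2 M] dim three by (simp add: numeral_3_eq_3 numeral_2_eq_2)
  with two show ?thesis
    by blast
qed

end
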